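(* Let $B$ be a finite subset of $\mathrm{M}$. Then $\mathrm{SAT}(\{\mathsf{F},\mathsf{G},\mathsf{X},\mathsf{U},\mathsf{S}\},B)$ can be decided in polynomial time.
   Context: A Boolean function is a map $f:\{0,1\}^n\to\{0,1\}$; each is used as an $n$-ary propositional connective. $\mathrm{M}$ is the set of monotone Boolean functions ($a_1\le b_1,\dots,a_n\le b_n$ implies $f(a_1,\dots,a_n)\le f(b_1,\dots,b_n)$). A temporal $B$-formula over a set $M$ of temporal operators is built from propositional variables using connectives from $B$ and operators from $M$. A structure $S=(s,V,\xi)$ is an infinite sequence $(s_i)_{i\in\mathbb N}$ of distinct states, a variable set $V$, and $\xi$ assigning to each state the set of variables true there. Semantics: $S,s_i\models x$ iff $x\in\xi(s_i)$; Boolean connectives pointwise; $S,s_i\models\mathsf{X}\varphi$ iff $S,s_{i+1}\models\varphi$; $S,s_i\models\varphi_1\mathsf{U}\varphi_2$ iff some $k\ge i$ has $S,s_k\models\varphi_2$ and $S,s_j\models\varphi_1$ for all $i\le j<k$; $S,s_i\models\varphi_1\mathsf{S}\varphi_2$ iff some $k\le i$ has $S,s_k\models\varphi_2$ and $S,s_j\models\varphi_1$ for all $k<j\le i$; $\mathsf{F}\varphi=\mathrm{true}\,\mathsf{U}\,\varphi$, $\mathsf{G}\varphi=\neg\mathsf{F}\neg\varphi$. A formula is satisfiable if it holds at some state of some structure. $\mathrm{SAT}(M,B)$ is the problem of deciding satisfiability of temporal $B$-formulae over $M$. *)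

theory Defs
  imports Main "HOL-Library.FuncSet" "HOL-Computational_Algebra.Polynomial"
begin

section \<open>Boolean functions\<close>

text \<open>A Boolean function is its arity \<open>n\<close> together with a map on bit lists of length \<open>n\<close>.
  Extensionality makes two Boolean functions equal as soon as they agree on all arguments.\<close>

type_synonym boolfun = "nat \<times> (bool list \<Rightarrow> bool)"

definition boolfuns :: "boolfun set" where
  "boolfuns = (SIGMA n:UNIV. {a. length a = n} \<rightarrow>\<^sub>E UNIV)"

definition monotone_boolfuns :: "boolfun set" where
  "monotone_boolfuns =
     {(n, f) \<in> boolfuns. \<forall>a b. length a = n \<and> length b = n \<and> (\<forall>i<n. a ! i \<le> b ! i) \<longrightarrow> f a \<le> f b}"

section \<open>Temporal formulae\<close>

datatype temporal_op = OpF | OpG | OpX | OpU | OpS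

datatype formula =
    Var nat
  | Conn boolfun "formula list"
  | Future formula
  | Globally formula
  | Next formula
  | Until formula formula
  | Since formula formula

inductive_set temporal_formulas :: "temporal_op set \<Rightarrow> boolfun set \<Rightarrow> formula set"
  for M :: "temporal_op set" and B :: "boolfun set" where
  "Var x \<in> temporal_formulas M B"
| "f \<in> B \<Longrightarrow> length \<phi>s = fst f \<Longrightarrow> \<forall>\<phi> \<in> set \<phi>s. \<phi> \<in> temporal_formulas M B
     \<Longrightarrow> Conn f \<phi>s \<in> temporal_formulas M B"
| "OpF \<in> M \<Longrightarrow> \<phi> \<in> temporal_formulas M B \<Longrightarrow> Future \<phi> \<in> temporal_formulas M B"
| "OpG \<in> M \<Longrightarrow> \<phi> \<in> temporal_formulas M B \<Longrightarrow> Globally \<phi> \<in> temporal_formulas M B"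
| "OpX \<in> M \<Longrightarrow> \<phi> \<in> temporal_formulas M B \<Longrightarrow> Next \<phi> \<in> temporal_formulas M B"
| "OpU \<in> M \<Longrightarrow> \<phi> \<in> temporal_formulas M B \<Longrightarrow> \<psi> \<in> temporal_formulas M B
     \<Longrightarrow> Until \<phi> \<psi> \<in> temporal_formulas M B"
| "OpS \<in> M \<Longrightarrow> \<phi> \<in> temporal_formulas M B \<Longrightarrow> \<psi> \<in> temporal_formulas M B
     \<Longrightarrow> Since \<phi> \<psi> \<in> temporal_formulas M B"

section \<open>Structures and satisfiability\<close>

record 's temporal_structure =
  state_at :: "nat \<Rightarrow> 's"
  variables :: "nat set"
  valuation :: "'s \<Rightarrow> nat set"

definition is_structure :: "'s temporal_structure \<Rightarrow> bool" where
  "is_structure S \<longleftrightarrow> inj (state_at S) \<and> (\<forall>i. valuation S (state_at S i) \<subseteq> variables S)"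

definition until :: "(nat \<Rightarrow> bool) \<Rightarrow> (nat \<Rightarrow> bool) \<Rightarrow> nat \<Rightarrow> bool" where
  "until P Q i \<longleftrightarrow> (\<exists>k\<ge>i. Q k \<and> (\<forall>j. i \<le> j \<and> j < k \<longrightarrow> P j))"

definition since :: "(nat \<Rightarrow> bool) \<Rightarrow> (nat \<Rightarrow> bool) \<Rightarrow> nat \<Rightarrow> bool" where
  "since P Q i \<longleftrightarrow> (\<exists>k\<le>i. Q k \<and> (\<forall>j. k < j \<and> j \<le> i \<longrightarrow> P j))"

text \<open>\<open>holds S i \<phi>\<close> is truth of \<open>\<phi>\<close> at the state \<open>state_at S i\<close>. The clauses for
  \<open>Future\<close> and \<open>Globally\<close> are those of \<open>true U \<phi>\<close> and \<open>\<not> F \<not> \<phi>\<close>; they are primitive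
  formulae here because \<open>true\<close> and \<open>\<not>\<close> need not be connectives of the formula.\<close>

fun holds :: "'s temporal_structure \<Rightarrow> nat \<Rightarrow> formula \<Rightarrow> bool" where
  "holds S i (Var x) \<longleftrightarrow> x \<in> valuation S (state_at S i)"
| "holds S i (Conn f \<phi>s) \<longleftrightarrow> snd f (map (holds S i) \<phi>s)"
| "holds S i (Future \<phi>) \<longleftrightarrow> until (\<lambda>_. True) (\<lambda>k. holds S k \<phi>) i"
| "holds S i (Globally \<phi>) \<longleftrightarrow> \<not> until (\<lambda>_. True) (\<lambda>k. \<not> holds S k \<phi>) i"
| "holds S i (Next \<phi>) \<longleftrightarrow> holds S (i + 1) \<phi>"
| "holds S i (Until \<phi> \<psi>) \<longleftrightarrow> until (\<lambda>j. holds S j \<phi>) (\<lambda>k. holds S k \<psi>) i"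
| "holds S i (Since \<phi> \<psi>) \<longleftrightarrow> since (\<lambda>j. holds S j \<phi>) (\<lambda>k. holds S k \<psi>) i"

text \<open>A structure has countably many states, so states may be taken to be natural numbers.\<close>

definition satisfiable :: "formula \<Rightarrow> bool" where
  "satisfiable \<phi> \<longleftrightarrow> (\<exists>(S :: nat temporal_structure) i. is_structure S \<and> holds S i \<phi>)"

section \<open>Formulae as words over a finite alphabet\<close>

text \<open>Formulae are written in prefix notation. Each connective and each temporal operator is one
  letter; the variable with index \<open>n\<close> is the letter \<open>SVar\<close> followed by \<open>n\<close> in binary, most
  significant bit first, without leading zeros.\<close>

datatype symbol = SVar | SBit bool | SConn boolfun | STemp temporal_op

fun binary :: "nat \<Rightarrow> bool list" where
  "binary n = (if n < 2 then [n = 1] else binary (n div 2) @ [odd n])"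

declare binary.simps [simp del]

fun encode :: "formula \<Rightarrow> symbol list" where
  "encode (Var n) = SVar # map SBit (binary n)"
| "encode (Conn f \<phi>s) = SConn f # concat (map encode \<phi>s)"
| "encode (Future \<phi>) = STemp OpF # encode \<phi>"
| "encode (Globally \<phi>) = STemp OpG # encode \<phi>"
| "encode (Next \<phi>) = STemp OpX # encode \<phi>"
| "encode (Until \<phi> \<psi>) = STemp OpU # encode \<phi> @ encode \<psi>"
| "encode (Since \<phi> \<psi>) = STemp OpS # encode \<phi> @ encode \<psi>"

definition alphabet :: "temporal_op set \<Rightarrow> boolfun set \<Rightarrow> symbol set" where
  "alphabet M B = {SVar} \<union> range SBit \<union> SConn ` B \<union> STemp ` M"

definition SAT :: "temporal_op set \<Rightarrow> boolfun set \<Rightarrow> symbol list set" where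
  "SAT M B = {encode \<phi> | \<phi>. \<phi> \<in> temporal_formulas M B \<and> satisfiable \<phi>}"

lemma binary_inject: "binary m = binary n \<Longrightarrow> m = n"
proof (induction m arbitrary: n rule: less_induct)
  case (less m)
  have ne: "binary k \<noteq> []" for k
    by (subst binary.simps) simp
  show ?case
  proof (cases "m < 2 \<or> n < 2")
    case True
    then show ?thesis
      using less.prems ne ne[symmetric]
      by (auto simp: binary.simps[of m] binary.simps[of n] split: if_splits)
  next
    case False
    then have eq: "binary (m div 2) @ [odd m] = binary (n div 2) @ [odd n]"
      using less.prems by (simp add: binary.simps[of m] binary.simps[of n])
    then have "m div 2 = n div 2"
      using False less.IH[of "m div 2" "n div 2"] by simp
    moreover have "odd m \<longleftrightarrow> odd n" using eq by simp
    ultimately show ?thesis by presburger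
  qed
qed

definition bit_free_start :: "symbol list \<Rightarrow> bool" where
  "bit_free_start r \<longleftrightarrow> (\<forall>b s. r \<noteq> SBit b # s)"

lemma bits_append_inject:
  "map SBit u @ r = map SBit v @ s \<Longrightarrow> bit_free_start r \<Longrightarrow> bit_free_start s \<Longrightarrow> u = v \<and> r = s"
proof (induction u arbitrary: v)
  case Nil
  then show ?case by (cases v) (auto simp: bit_free_start_def)
next
  case (Cons a u)
  from Cons.prems obtain v' where v: "v = a # v'" and eq: "map SBit u @ r = map SBit v' @ s"
    by (cases v) (auto simp: bit_free_start_def)
  show ?case using Cons.IH[OF eq Cons.prems(2,3)] v by simp
qed

lemma bit_free_start_encode: "bit_free_start (encode \<phi> @ r)"
  by (cases \<phi>) (auto simp: bit_free_start_def)

lemma bit_free_start_encode_list: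
  "bit_free_start r \<Longrightarrow> bit_free_start (concat (map encode \<phi>s) @ r)"
  by (cases \<phi>s) (auto simp: bit_free_start_encode)

inductive_simps temporal_formulas_simps:
  "Conn f \<phi>s \<in> temporal_formulas M B"
  "Future \<phi> \<in> temporal_formulas M B"
  "Globally \<phi> \<in> temporal_formulas M B"
  "Next \<phi> \<in> temporal_formulas M B"
  "Until \<phi> \<psi> \<in> temporal_formulas M B"
  "Since \<phi> \<psi> \<in> temporal_formulas M B"

lemma encode_append_inject:
  assumes "\<phi> \<in> temporal_formulas M B" "\<psi> \<in> temporal_formulas M B"
    and "encode \<phi> @ r = encode \<psi> @ s" "bit_free_start r" "bit_free_start s"
  shows "\<phi> = \<psi> \<and> r = s"
  using assms
proof (induction \<phi> arbitrary: \<psi> r s rule: temporal_formulas.induct)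
  case (1 x)
  then show ?case
    by (cases \<psi>) (auto dest: bits_append_inject binary_inject)
next
  case (2 f \<phi>s)
  from "2.prems" obtain \<psi>s where \<psi>: "\<psi> = Conn f \<psi>s"
    and eq: "concat (map encode \<phi>s) @ r = concat (map encode \<psi>s) @ s"
    by (cases \<psi>) auto
  from "2.prems"(1) \<psi> have \<psi>s: "length \<psi>s = fst f" "\<forall>\<psi> \<in> set \<psi>s. \<psi> \<in> temporal_formulas M B"
    by (simp_all add: temporal_formulas_simps)
  have "length \<phi>s = length \<psi>s" using \<psi>s "2.hyps" by simp
  then have "\<phi>s = \<psi>s \<and> r = s"
    using "2.IH" \<psi>s(2) eq
  proof (induction \<phi>s \<psi>s rule: list_induct2)
    case Nil
    then show ?case by simp
  next
    case (Cons a as b bs)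
    have "a = b \<and> concat (map encode as) @ r = concat (map encode bs) @ s"
    proof -
      have IH: "\<psi> \<in> temporal_formulas M B \<Longrightarrow> encode a @ r = encode \<psi> @ s \<Longrightarrow>
          bit_free_start r \<Longrightarrow> bit_free_start s \<Longrightarrow> a = \<psi> \<and> r = s" for \<psi> r s
        using bspec[OF Cons.prems(1) list.set_intros(1)] by blast
      have "b \<in> temporal_formulas M B" using Cons.prems(2) by simp
      moreover have "encode a @ concat (map encode as) @ r = encode b @ concat (map encode bs) @ s"
        using Cons.prems(3) by simp
      ultimately show ?thesis
        using "2.prems"(3,4) by (intro IH bit_free_start_encode_list)
    qed
    moreover have "as = bs \<and> r = s"
    proof (rule Cons.IH)
      show "concat (map encode as) @ r = concat (map encode bs) @ s" using calculation by (rule conjunct2)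
    qed (rule ballI, rule Cons.prems(1,2)[THEN bspec], erule list.set_intros(2))+
    ultimately show ?case by blast
  qed
  then show ?case using \<psi> by simp
next
  case (3 \<phi>)
  from "3.prems" obtain \<phi>' where \<psi>: "\<psi> = Future \<phi>'" and eq: "encode \<phi> @ r = encode \<phi>' @ s"
    by (cases \<psi>) auto
  from "3.prems"(1) \<psi> have "\<phi>' \<in> temporal_formulas M B"
    by (simp add: temporal_formulas_simps)
  then show ?case
    using "3.IH"[OF _ eq] "3.prems"(3,4) \<psi> by blast
next
  case (4 \<phi>)
  from "4.prems" obtain \<phi>' where \<psi>: "\<psi> = Globally \<phi>'" and eq: "encode \<phi> @ r = encode \<phi>' @ s"
    by (cases \<psi>) auto
  from "4.prems"(1) \<psi> have "\<phi>' \<in> temporal_formulas M B"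
    by (simp add: temporal_formulas_simps)
  then show ?case
    using "4.IH"[OF _ eq] "4.prems"(3,4) \<psi> by blast
next
  case (5 \<phi>)
  from "5.prems" obtain \<phi>' where \<psi>: "\<psi> = Next \<phi>'" and eq: "encode \<phi> @ r = encode \<phi>' @ s"
    by (cases \<psi>) auto
  from "5.prems"(1) \<psi> have "\<phi>' \<in> temporal_formulas M B"
    by (simp add: temporal_formulas_simps)
  then show ?case
    using "5.IH"[OF _ eq] "5.prems"(3,4) \<psi> by blast
next
  case (6 \<phi> \<chi>)
  from "6.prems" obtain \<phi>' \<chi>' where \<psi>: "\<psi> = Until \<phi>' \<chi>'"
    and eq: "encode \<phi> @ encode \<chi> @ r = encode \<phi>' @ encode \<chi>' @ s"
    by (cases \<psi>) auto
  from "6.prems"(1) \<psi> have "\<phi>' \<in> temporal_formulas M B" "\<chi>' \<in> temporal_formulas M B"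
    by (simp_all add: temporal_formulas_simps)
  then show ?case
    using "6.IH"(1)[OF _ eq] "6.IH"(2)[of \<chi>' r s] "6.prems"(3,4) \<psi> bit_free_start_encode by blast
next
  case (7 \<phi> \<chi>)
  from "7.prems" obtain \<phi>' \<chi>' where \<psi>: "\<psi> = Since \<phi>' \<chi>'"
    and eq: "encode \<phi> @ encode \<chi> @ r = encode \<phi>' @ encode \<chi>' @ s"
    by (cases \<psi>) auto
  from "7.prems"(1) \<psi> have "\<phi>' \<in> temporal_formulas M B" "\<chi>' \<in> temporal_formulas M B"
    by (simp_all add: temporal_formulas_simps)
  then show ?case
    using "7.IH"(1)[OF _ eq] "7.IH"(2)[of \<chi>' r s] "7.prems"(3,4) \<psi> bit_free_start_encode by blast
qed

lemma inj_on_encode: "inj_on encode (temporal_formulas M B)"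
proof (rule inj_onI)
  fix \<phi> \<psi>
  assume "\<phi> \<in> temporal_formulas M B" "\<psi> \<in> temporal_formulas M B" "encode \<phi> = encode \<psi>"
  then show "\<phi> = \<psi>"
    using encode_append_inject[of \<phi> M B \<psi> "[]" "[]"] by (simp add: bit_free_start_def)
qed

section \<open>Polynomial time\<close>

text \<open>Deterministic Turing machines with a fixed number of two-way infinite tapes. States are
  natural numbers; a tape cell holds the blank, an input letter or an auxiliary letter.
  A tape is given by its contents and its head position.\<close>

datatype 'a cell = Blank | Inp 'a | Aux nat

datatype direction = MoveLeft | Stay | MoveRight

record 'a machine =
  tapes :: nat
  states :: "nat set"
  tape_alphabet :: "'a cell set"
  start :: nat
  accept :: nat
  reject :: nat
  trans :: "nat \<Rightarrow> 'a cell list \<Rightarrow> nat \<times> ('a cell \<times> direction) list"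

definition is_machine :: "'a set \<Rightarrow> 'a machine \<Rightarrow> bool" where
  "is_machine \<Sigma> T \<longleftrightarrow>
     tapes T \<ge> 1 \<and>
     finite (states T) \<and> {start T, accept T, reject T} \<subseteq> states T \<and> accept T \<noteq> reject T \<and>
     finite (tape_alphabet T) \<and> insert Blank (Inp ` \<Sigma>) \<subseteq> tape_alphabet T \<and>
     (\<forall>q \<in> states T. \<forall>cs \<in> lists (tape_alphabet T). length cs = tapes T \<longrightarrow>
        fst (trans T q cs) \<in> states T \<and>
        length (snd (trans T q cs)) = tapes T \<and>
        snd (trans T q cs) \<in> lists (tape_alphabet T \<times> UNIV))"

type_synonym 'a tape = "(int \<Rightarrow> 'a cell) \<times> int"

type_synonym 'a configuration = "nat \<times> 'a tape list"

fun shift :: "direction \<Rightarrow> int" where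
  "shift MoveLeft = -1"
| "shift Stay = 0"
| "shift MoveRight = 1"

fun scan :: "'a tape \<Rightarrow> 'a cell" where
  "scan (c, h) = c h"

fun act :: "'a tape \<Rightarrow> 'a cell \<times> direction \<Rightarrow> 'a tape" where
  "act (c, h) (x, d) = (c(h := x), h + shift d)"

fun step :: "'a machine \<Rightarrow> 'a configuration \<Rightarrow> 'a configuration" where
  "step T (q, ts) =
     (if q \<in> {accept T, reject T} then (q, ts)
      else let (q', as) = trans T q (map scan ts) in (q', map2 act ts as))"

definition input_tape :: "'a list \<Rightarrow> 'a tape" where
  "input_tape w = ((\<lambda>i. if 0 \<le> i \<and> i < int (length w) then Inp (w ! nat i) else Blank), 0)"

definition initial :: "'a machine \<Rightarrow> 'a list \<Rightarrow> 'a configuration" where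
  "initial T w = (start T, input_tape w # replicate (tapes T - 1) (input_tape []))"

definition decides_in_time ::
    "'a set \<Rightarrow> 'a machine \<Rightarrow> 'a list set \<Rightarrow> (nat \<Rightarrow> nat) \<Rightarrow> bool" where
  "decides_in_time \<Sigma> T L t \<longleftrightarrow>
     (\<forall>w \<in> lists \<Sigma>. \<exists>k \<le> t (length w).
        fst ((step T ^^ k) (initial T w)) = (if w \<in> L then accept T else reject T))"

definition polytime_decidable :: "'a set \<Rightarrow> 'a list set \<Rightarrow> bool" where
  "polytime_decidable \<Sigma> L \<longleftrightarrow>
     finite \<Sigma> \<and> L \<subseteq> lists \<Sigma> \<and>
     (\<exists>T (p :: nat poly). is_machine \<Sigma> T \<and> decides_in_time \<Sigma> T L (poly p))"

end

theory Submission
  imports Defs "HOL-Library.Countable"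
begin

text \<open>Making every variable true at every state can only help a monotone formula, and in that
  structure the truth value of a formula does not depend on the state: \<open>F\<close>, \<open>G\<close>, \<open>X\<close> act as the
  identity and \<open>U\<close>, \<open>S\<close> return their second argument. Satisfiability is therefore the evaluation
  of a Boolean expression, which a two-tape machine performs by scanning the prefix notation from
  right to left while keeping the values of the subformulae read so far on a stack.\<close>

section \<open>Satisfiability of monotone formulae\<close>

fun all_true_value :: "formula \<Rightarrow> bool" where
  "all_true_value (Var x) = True"
| "all_true_value (Conn f \<phi>s) = snd f (map all_true_value \<phi>s)"
| "all_true_value (Future \<phi>) = all_true_value \<phi>"
| "all_true_value (Globally \<phi>) = all_true_value \<phi>"
| "all_true_value (Next \<phi>) = all_true_value \<phi>"
| "all_true_value (Until \<phi> \<psi>) = all_true_value \<psi>"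
| "all_true_value (Since \<phi> \<psi>) = all_true_value \<psi>"

lemma monotone_boolfunD:
  assumes "f \<in> monotone_boolfuns" "length a = fst f" "length b = fst f"
    and "\<And>i. i < fst f \<Longrightarrow> a ! i \<Longrightarrow> b ! i" and "snd f a"
  shows "snd f b"
  using assms by (cases f) (auto simp: monotone_boolfuns_def le_bool_def)

text \<open>Induction over all states at once: a true temporal formula exhibits some state, possibly
  another one, where its argument (the second one for \<open>Until\<close> and \<open>Since\<close>)
  is true. Connectives use monotonicity, comparing argument values pointwise.\<close>

lemma holds_imp_all_true_value:
  assumes "\<phi> \<in> temporal_formulas M B" "B \<subseteq> monotone_boolfuns" "holds S i \<phi>"
  shows "all_true_value \<phi>"
  using assms
proof (induction \<phi> arbitrary: i rule: temporal_formulas.induct)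
  case (2 f \<phi>s)
  have "snd f (map all_true_value \<phi>s)"
    by (rule monotone_boolfunD[of f "map (holds S i) \<phi>s"]) (use 2 in auto)
  then show ?case by simp
qed (auto simp: until_def since_def)

definition all_true :: "nat temporal_structure" where
  "all_true = \<lparr>state_at = id, variables = UNIV, valuation = (\<lambda>_. UNIV)\<rparr>"

text \<open>For \<open>Until\<close> and \<open>Since\<close> the witness \<open>k = i\<close> makes
  the condition on the first argument vacuous.\<close>

lemma holds_all_true: "holds all_true i \<phi> = all_true_value \<phi>"
proof (induction \<phi> arbitrary: i)
  case (Conn f \<phi>s)
  then have "map (holds all_true i) \<phi>s = map all_true_value \<phi>s" by simp
  then show ?case by (simp only: holds.simps all_true_value.simps)
next
  case (Until \<phi> \<psi>)
  then show ?case by (auto simp: until_def)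
next
  case (Since \<phi> \<psi>)
  then show ?case by (auto simp: since_def)
qed (auto simp: all_true_def until_def)

lemma satisfiable_iff_all_true_value:
  assumes "\<phi> \<in> temporal_formulas M B" "B \<subseteq> monotone_boolfuns"
  shows "satisfiable \<phi> \<longleftrightarrow> all_true_value \<phi>"
proof
  assume "all_true_value \<phi>"
  then have "holds all_true 0 \<phi>" by (simp add: holds_all_true)
  moreover have "is_structure all_true" by (simp add: is_structure_def all_true_def)
  ultimately show "satisfiable \<phi>" unfolding satisfiable_def by blast
qed (use assms holds_imp_all_true_value in \<open>auto simp: satisfiable_def\<close>)

section \<open>Evaluation of prefix notation from right to left\<close>

text \<open>Temporal operators become projections. Scanning from right to left leaves the leftmost
  argument on top of the stack, so index 1 is the second argument as written.\<close>

fun symbol_fun :: "symbol \<Rightarrow> nat \<times> (bool list \<Rightarrow> bool)" where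
  "symbol_fun (SConn f) = f"
| "symbol_fun (STemp t) = (if t \<in> {OpU, OpS} then (2, \<lambda>a. a ! 1) else (1, \<lambda>a. a ! 0))"
| "symbol_fun _ = (0, \<lambda>_. True)"

text \<open>All that must be remembered of a block of bits read so far: whether it is a single bit, and
  its leading bit.\<close>

type_synonym pending = "(bool \<times> bool) option"

definition pending_of :: "bool list \<Rightarrow> pending" where
  "pending_of bs = (if bs = [] then None else Some (tl bs = [], hd bs))"

text \<open>The well-formedness test for bits: they may stand only right after \<open>SVar\<close>,
  where they must form a numeral without leading zeros.\<close>

fun admissible :: "pending \<Rightarrow> symbol \<Rightarrow> bool" where
  "admissible p SVar = (case p of None \<Rightarrow> False | Some (single, leading) \<Rightarrow> single \<or> leading)"
| "admissible p _ = (p = None)"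

text \<open>Evaluation also parses: missing arguments, stray bits and leftover values all lead to
  rejection. Bits arrive from the right, so the newest one is the leading one.\<close>

fun evaluate :: "pending \<Rightarrow> bool list \<Rightarrow> symbol list \<Rightarrow> bool" where
  "evaluate p vs [] \<longleftrightarrow> p = None \<and> vs = [True]"
| "evaluate p vs (SBit b # r) = evaluate (Some (p = None, b)) vs r"
| "evaluate p vs (s # r) \<longleftrightarrow>
     admissible p s \<and> fst (symbol_fun s) \<le> length vs \<and>
     evaluate None (snd (symbol_fun s) (take (fst (symbol_fun s)) vs) # drop (fst (symbol_fun s)) vs) r"

lemma evaluate_not_bit:
  assumes "s \<notin> range SBit"
  shows "evaluate p vs (s # r) \<longleftrightarrow>
     admissible p s \<and> fst (symbol_fun s) \<le> length vs \<and>
     evaluate None (snd (symbol_fun s) (take (fst (symbol_fun s)) vs) # drop (fst (symbol_fun s)) vs) r"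
  using assms by (cases s) auto

lemma pending_of_Nil [simp]: "pending_of [] = None"
  by (simp add: pending_of_def)

lemma pending_of_Cons: "pending_of (b # bs) = Some (pending_of bs = None, b)"
  by (simp add: pending_of_def)

lemma evaluate_bits:
  "evaluate (pending_of cs) vs (rev (map SBit bs) @ r) = evaluate (pending_of (bs @ cs)) vs r"
proof (induction bs arbitrary: cs rule: rev_induct)
  case (snoc b bs)
  show ?case using snoc[of "b # cs"] by (simp add: pending_of_Cons)
qed simp

section \<open>Binary numerals without leading zeros\<close>

lemma binary_not_Nil: "binary n \<noteq> []"
  by (subst binary.simps) simp

lemma hd_binary: "n > 0 \<Longrightarrow> hd (binary n)"
proof (induction n rule: less_induct)
  case (less n)
  show ?case
  proof (cases "n < 2")
    case True
    then show ?thesis using less.prems by (subst binary.simps) simp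
  next
    case False
    then have "hd (binary (n div 2))" using less.IH[of "n div 2"] by simp
    then show ?thesis using False binary_not_Nil[of "n div 2"] by (subst binary.simps) simp
  qed
qed

lemma binary_no_leading_zero: "tl (binary n) = [] \<or> hd (binary n)"
  using hd_binary[of n] binary.simps[of 0] by (cases "n = 0") auto

lemma binary_surj:
  assumes "bs \<noteq> []" "tl bs = [] \<or> hd bs"
  shows "\<exists>n. binary n = bs"
proof -
  \<comment> \<open>Positivity is carried through the induction: with \<open>n > 0\<close> the
    number \<open>2 * n + of_bool b\<close> is at least 2, so \<open>binary\<close> unfolds by its
    recursive branch and not by its one-bit base case.\<close>
  have "\<exists>n. binary n = bs \<and> (hd bs \<longrightarrow> n > 0)"
    using assms
  proof (induction bs rule: rev_induct)
    case (snoc b bs)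
    show ?case
    proof (cases "bs = []")
      case True
      then show ?thesis by (intro exI[of _ "of_bool b"]) (auto simp: binary.simps)
    next
      case False
      then have hd: "hd bs" using snoc.prems by (auto simp: tl_append split: list.splits)
      then obtain n where "binary n = bs" "n > 0" using snoc.IH False by auto
      then have "binary (2 * n + of_bool b) = bs @ [b]" by (subst binary.simps) auto
      then show ?thesis using \<open>n > 0\<close> by (intro exI[of _ "2 * n + of_bool b"]) auto
    qed
  qed simp
  then show ?thesis by blast
qed

lemma admissible_pending_of_SVar:
  "admissible (pending_of bs) SVar \<longleftrightarrow> bs \<noteq> [] \<and> (tl bs = [] \<or> hd bs)"
  by (auto simp: pending_of_def)

section \<open>Correctness of the evaluation on encodings\<close>

text \<open>The last formula is read first and lands deepest, so the values end up in argument
  order. The assumption stands for the induction hypothesis available in the connective case of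
  \<open>evaluate_rev_encode\<close>.\<close>

lemma evaluate_rev_encodes:
  assumes "\<And>\<phi> vs r. \<phi> \<in> set \<phi>s \<Longrightarrow>
    evaluate None vs (rev (encode \<phi>) @ r) = evaluate None (all_true_value \<phi> # vs) r"
  shows "evaluate None vs (rev (concat (map encode \<phi>s)) @ r)
    = evaluate None (map all_true_value \<phi>s @ vs) r"
  using assms by (induction \<phi>s arbitrary: vs r) simp_all

text \<open>Reading a complete encoding has the sole effect of pushing its value; arbitrary
  \<open>vs\<close> and \<open>r\<close> let consecutive subformulae be chained.\<close>

lemma evaluate_rev_encode:
  assumes "\<phi> \<in> temporal_formulas M B"
  shows "evaluate None vs (rev (encode \<phi>) @ r) = evaluate None (all_true_value \<phi> # vs) r"
  using assms
proof (induction \<phi> arbitrary: vs r rule: temporal_formulas.induct)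
  case (1 x)
  show ?case
    using evaluate_bits[of "[]" vs "binary x" "SVar # r"]
      admissible_pending_of_SVar[of "binary x"] binary_not_Nil[of x] binary_no_leading_zero[of x]
    by simp
next
  case (2 f \<phi>s)
  have "evaluate None vs (rev (concat (map encode \<phi>s)) @ SConn f # r)
    = evaluate None (map all_true_value \<phi>s @ vs) (SConn f # r)"
    by (rule evaluate_rev_encodes) (use 2 in blast)
  then show ?case using 2 by simp
qed simp_all

text \<open>The suffix \<open>u\<close> already scanned is a block of bits followed by formulae whose values form the
  stack.\<close>

lemma evaluate_imp_encode:
  assumes "evaluate (pending_of bs) (map all_true_value \<phi>s) r"
    and "set \<phi>s \<subseteq> temporal_formulas M B" and "set r \<subseteq> alphabet M B"
    and "u = map SBit bs @ concat (map encode \<phi>s)"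
  shows "\<exists>\<phi> \<in> temporal_formulas M B. all_true_value \<phi> \<and> rev r @ u = encode \<phi>"
  using assms
proof (induction r arbitrary: bs \<phi>s u)
  case Nil
  then obtain \<phi> where "\<phi>s = [\<phi>]" "all_true_value \<phi>" "bs = []"
    by (auto simp: pending_of_def split: if_splits)
  then show ?case using Nil by (intro bexI[of _ \<phi>]) auto
next
  case (Cons s r)
  show ?case
  proof (cases "s \<in> range SBit")
    case True
    then obtain b where s: "s = SBit b" by blast
    \<comment> \<open>A bit extends the pending block to the left and completes no formula.\<close>
    have "\<exists>\<phi> \<in> temporal_formulas M B. all_true_value \<phi> \<and> rev r @ s # u = encode \<phi>"
      by (rule Cons.IH[of "b # bs" \<phi>s]) (use Cons.prems s in \<open>auto simp: pending_of_Cons\<close>)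
    then show ?thesis by simp
  next
    case False
    define n where "n = fst (symbol_fun s)"
    define v where "v = snd (symbol_fun s) (take n (map all_true_value \<phi>s))"
    from Cons.prems(1) False have adm: "admissible (pending_of bs) s" and n: "n \<le> length \<phi>s"
      and ev: "evaluate None (v # drop n (map all_true_value \<phi>s)) r"
      by (simp_all add: evaluate_not_bit n_def v_def)
    have args: "set (take n \<phi>s) \<subseteq> temporal_formulas M B"
      using Cons.prems(2) set_take_subset[of n \<phi>s] by (rule order_trans[rotated])
    have s: "s \<in> alphabet M B" using Cons.prems(3) by simp
    \<comment> \<open>The letter forms one new formula with the top \<open>n\<close> formulae, or
      with the bit block if it is \<open>SVar\<close>.\<close>
    have "\<exists>\<phi> \<in> temporal_formulas M B.
        all_true_value \<phi> = v \<and> encode \<phi> = s # map SBit bs @ concat (map encode (take n \<phi>s))"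
    proof (cases s)
      case SVar
      then obtain x where "binary x = bs" using adm admissible_pending_of_SVar binary_surj by metis
      then show ?thesis using SVar
        by (intro bexI[of _ "Var x"]) (auto simp: n_def v_def intro: temporal_formulas.intros)
    next
      case (SBit b)
      then show ?thesis using False by blast
    next
      case (SConn f)
      then have "f \<in> B" using s by (auto simp: alphabet_def)
      moreover have "bs = []" using adm SConn by (auto simp: pending_of_def split: if_splits)
      ultimately show ?thesis using SConn n args
        by (intro bexI[of _ "Conn f (take n \<phi>s)"])
          (auto simp: n_def v_def take_map temporal_formulas_simps)
    next
      case (STemp t)
      then have t: "t \<in> M" using s by (auto simp: alphabet_def)
      have bs: "bs = []" using adm STemp by (auto simp: pending_of_def split: if_splits)
      show ?thesis
      proof (cases "t \<in> {OpU, OpS}")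
        case True
        then have "n = 2" using STemp by (simp add: n_def)
        then obtain \<phi> \<psi> where tk: "take n \<phi>s = [\<phi>, \<psi>]"
          using n by (cases \<phi>s; cases "tl \<phi>s") auto
        then have "v = all_true_value \<psi>" using True STemp by (auto simp: v_def take_map)
        then show ?thesis using True STemp tk args t bs
          by (intro bexI[of _ "if t = OpU then Until \<phi> \<psi> else Since \<phi> \<psi>"])
            (auto simp: temporal_formulas_simps)
      next
        case F: False
        then have "n = 1" using STemp by (simp add: n_def)
        then obtain \<phi> where tk: "take n \<phi>s = [\<phi>]" using n by (cases \<phi>s) auto
        then have v: "v = all_true_value \<phi>" using F STemp by (auto simp: v_def take_map)
        show ?thesis using F STemp tk args t bs v
          by (intro bexI[of _ "if t = OpF then Future \<phi> else if t = OpG then Globally \<phi> else Next \<phi>"];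
              cases t) (auto simp: temporal_formulas_simps)
      qed
    qed
    then obtain \<phi> where \<phi>: "\<phi> \<in> temporal_formulas M B" "all_true_value \<phi> = v"
      "encode \<phi> = s # map SBit bs @ concat (map encode (take n \<phi>s))" by blast
    \<comment> \<open>Putting \<phi> in place of its parts regroups the scanned suffix without
      changing it as a word, so the induction hypothesis applies with an empty block.\<close>
    have "concat (map encode (take n \<phi>s)) @ concat (map encode (drop n \<phi>s)) = concat (map encode \<phi>s)"
      by (metis append_take_drop_id concat_append map_append)
    then have "s # u = map SBit [] @ concat (map encode (\<phi> # drop n \<phi>s))"
      using \<phi>(3) Cons.prems(4) by simp
    moreover have "set (\<phi> # drop n \<phi>s) \<subseteq> temporal_formulas M B"
      using \<phi>(1) Cons.prems(2) set_drop_subset[of n \<phi>s] by auto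
    moreover have "evaluate (pending_of []) (map all_true_value (\<phi> # drop n \<phi>s)) r"
      using ev \<phi>(2) by (simp add: drop_map)
    moreover have "set r \<subseteq> alphabet M B" using Cons.prems(3) by simp
    ultimately have "\<exists>\<phi> \<in> temporal_formulas M B. all_true_value \<phi> \<and> rev r @ s # u = encode \<phi>"
      using Cons.IH by blast
    then show ?thesis by simp
  qed
qed

text \<open>One run of \<open>evaluate\<close> settles both whether \<open>w\<close> encodes a
  formula and whether that formula has all-true value true, that is, is satisfiable.\<close>

lemma SAT_iff_evaluate:
  assumes "B \<subseteq> monotone_boolfuns" "w \<in> lists (alphabet M B)"
  shows "w \<in> SAT M B \<longleftrightarrow> evaluate None [] (rev w)"
proof
  assume "w \<in> SAT M B"
  then obtain \<phi> where \<phi>: "w = encode \<phi>" "\<phi> \<in> temporal_formulas M B" "all_true_value \<phi>"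
    using assms(1) satisfiable_iff_all_true_value by (auto simp: SAT_def)
  then show "evaluate None [] (rev w)"
    using evaluate_rev_encode[OF \<phi>(2), of "[]" "[]"] by simp
next
  assume "evaluate None [] (rev w)"
  then obtain \<phi> where "\<phi> \<in> temporal_formulas M B" "all_true_value \<phi>" "w = encode \<phi>"
    using evaluate_imp_encode[of "[]" "[]" "rev w" M B "[]"] assms(2) by auto
  then show "w \<in> SAT M B"
    using assms(1) satisfiable_iff_all_true_value by (auto simp: SAT_def)
qed

lemma encode_in_lists_alphabet:
  assumes "\<phi> \<in> temporal_formulas M B"
  shows "encode \<phi> \<in> lists (alphabet M B)"
  using assms
proof (induction rule: temporal_formulas.induct)
  case (2 f \<phi>s)
  then have "SConn f \<in> alphabet M B" by (simp add: alphabet_def)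
  then show ?case using 2 by (auto simp: in_lists_conv_set)
qed (auto simp: alphabet_def)

section \<open>The machine\<close>

text \<open>\<open>Scan p vs\<close> has popped \<open>vs\<close> from the stack as the first arguments of the symbol under the
  head of the input tape. The top of the stack is under the head of the second tape, so that a
  push takes two steps: \<open>Push v\<close> is entered with the head moved to the free cell.\<close>

datatype control = Seek | Scan pending "bool list" | Push bool | Check | Acc | Rej

instance control :: countable
  by countable_datatype

text \<open>\<open>Aux 1\<close> and \<open>Aux 0\<close> are the truth values on the stack. A pop
  records the value in the control and moves left; the old cell stays until a later push overwrites
  it. \<open>Check\<close> looks for the blank that marks the bottom of the stack.\<close>

fun control_step ::
    "control \<Rightarrow> symbol cell \<Rightarrow> symbol cell \<Rightarrow> control \<times> direction \<times> symbol cell \<times> direction" where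
  "control_step Seek a b =
     (if a = Blank then (Scan None [], MoveLeft, b, Stay) else (Seek, MoveRight, b, Stay))"
| "control_step (Scan p vs) (Inp s) b =
     (if s \<in> range SBit then (Scan (Some (p = None, s = SBit True)) [], MoveLeft, b, Stay)
      else if \<not> admissible p s then (Rej, Stay, b, Stay)
      else if length vs < fst (symbol_fun s) then
        (if b = Blank then (Rej, Stay, b, Stay)
         else (Scan p (vs @ [b = Aux 1]), Stay, b, MoveLeft))
      else (Push (snd (symbol_fun s) vs), Stay, b, MoveRight))"
| "control_step (Scan p vs) _ b =
     (if p = None \<and> b = Aux 1 then (Check, Stay, b, MoveLeft) else (Rej, Stay, b, Stay))"
| "control_step (Push v) a b = (Scan None [], MoveLeft, Aux (of_bool v), Stay)"
| "control_step Check a b = (if b = Blank then Acc else Rej, Stay, b, Stay)"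
| "control_step q a b = (q, Stay, b, Stay)"

text \<open>The bound \<open>N\<close>, later the maximal arity of a letter, keeps the control
  finite.\<close>

definition controls :: "nat \<Rightarrow> control set" where
  "controls N = {Seek, Check, Acc, Rej} \<union> range Push
     \<union> (\<lambda>(p, vs). Scan p vs) ` (UNIV \<times> {vs. length vs \<le> N})"

definition evaluator :: "symbol set \<Rightarrow> nat \<Rightarrow> symbol machine" where
  "evaluator \<Sigma> N = \<lparr>
     tapes = 2,
     states = to_nat ` controls N,
     tape_alphabet = {Blank, Aux 0, Aux 1} \<union> Inp ` \<Sigma>,
     start = to_nat Seek,
     accept = to_nat Acc,
     reject = to_nat Rej,
     trans = (\<lambda>q cs. case control_step (from_nat q) (cs ! 0) (cs ! 1) of
       (q', d, y, e) \<Rightarrow> (to_nat q', [(cs ! 0, d), (y, e)]))\<rparr>"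

section \<open>Well-formedness of the machine\<close>

lemma finite_controls: "finite (controls N)"
proof -
  have "finite {vs :: bool list. length vs \<le> N}"
    using finite_lists_length_le[of "UNIV :: bool set" N] by simp
  then show ?thesis by (simp add: controls_def)
qed

text \<open>The list of popped values grows only while it is shorter than the arity of the scanned
  letter, hence never beyond \<open>N\<close>.\<close>

lemma control_step_closed:
  assumes "\<And>s. s \<in> \<Sigma> \<Longrightarrow> fst (symbol_fun s) \<le> N"
    and "q \<in> controls N" "a \<in> {Blank, Aux 0, Aux 1} \<union> Inp ` \<Sigma>" "b \<in> {Blank, Aux 0, Aux 1} \<union> Inp ` \<Sigma>"
    and "control_step q a b = (q', d, y, e)"
  shows "q' \<in> controls N \<and> y \<in> {Blank, Aux 0, Aux 1} \<union> Inp ` \<Sigma>"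
proof (cases "\<exists>p vs s. q = Scan p vs \<and> a = Inp s")
  case True
  then obtain p vs s where q: "q = Scan p vs" and a: "a = Inp s" by blast
  then have "fst (symbol_fun s) \<le> N" "length vs \<le> N" using assms by (auto simp: controls_def)
  then show ?thesis using assms(4,5) q a by (auto simp: controls_def image_iff split: if_splits)
next
  case False
  then show ?thesis using assms(2-5)
    by (cases q; cases a) (auto simp: controls_def image_iff split: if_splits)
qed

lemma is_machine_evaluator:
  assumes "finite \<Sigma>" "\<And>s. s \<in> \<Sigma> \<Longrightarrow> fst (symbol_fun s) \<le> N"
  shows "is_machine \<Sigma> (evaluator \<Sigma> N)"
proof -
  let ?A = "{Blank, Aux 0, Aux 1} \<union> Inp ` \<Sigma>"
  have "fst (trans (evaluator \<Sigma> N) q cs) \<in> to_nat ` controls N \<and>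
      length (snd (trans (evaluator \<Sigma> N) q cs)) = 2 \<and>
      snd (trans (evaluator \<Sigma> N) q cs) \<in> lists (?A \<times> UNIV)"
    if q: "q \<in> to_nat ` controls N" and cs: "cs \<in> lists ?A" "length cs = 2" for q cs
  proof -
    obtain c where c: "c \<in> controls N" "q = to_nat c" using q by blast
    obtain a b where ab: "cs = [a, b]" "a \<in> ?A" "b \<in> ?A"
      using cs by (cases cs; cases "tl cs") auto
    obtain q' d y e where st: "control_step c a b = (q', d, y, e)" by (cases "control_step c a b") 
    then have "q' \<in> controls N" "y \<in> ?A"
      using control_step_closed[OF assms(2) c(1) ab(2,3) st] by blast+
    moreover have "trans (evaluator \<Sigma> N) q cs = (to_nat q', [(a, d), (y, e)])"
      using st c ab by (simp add: evaluator_def)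
    ultimately show ?thesis using ab(2) by simp
  qed
  then show ?thesis
    unfolding is_machine_def using assms(1) finite_controls[of N]
    by (auto simp: evaluator_def controls_def)
qed

text \<open>The input tape is never changed, so its contents \<open>c\<close> are a parameter.\<close>

definition config :: "(int \<Rightarrow> symbol cell) \<Rightarrow> control \<Rightarrow> int \<Rightarrow> symbol tape \<Rightarrow> symbol configuration" where
  "config c q h t = (to_nat q, [(c, h), t])"

lemma step_config:
  assumes "q \<notin> {Acc, Rej}" "control_step q (c h) (scan t) = (q', d, y, e)"
  shows "step (evaluator \<Sigma> N) (config c q h t) = config c q' (h + shift d) (act t (y, e))"
  using assms by (cases t) (auto simp: config_def evaluator_def)

text \<open>An upper bound instead of an exact step count lets branches of different lengths be
  padded to one budget.\<close>

definition halts_within :: "symbol machine \<Rightarrow> nat \<Rightarrow> symbol configuration \<Rightarrow> nat \<Rightarrow> bool" where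
  "halts_within T k conf q \<longleftrightarrow> (\<exists>j\<le>k. fst ((step T ^^ j) conf) = q)"

lemma halts_within_step:
  "halts_within T k (step T conf) q \<Longrightarrow> halts_within T (Suc k) conf q"
  unfolding halts_within_def by (metis Suc_le_mono comp_apply funpow_Suc_right)

lemma halts_within_mono: "halts_within T k conf q \<Longrightarrow> k \<le> l \<Longrightarrow> halts_within T l conf q"
  unfolding halts_within_def using le_trans by blast

lemma halts_within_now: "fst conf = q \<Longrightarrow> halts_within T k conf q"
  unfolding halts_within_def by (intro exI[of _ 0]) simp

lemma halts_within_config_step:
  assumes "q \<notin> {Acc, Rej}" "control_step q (c h) (scan t) = (q', d, y, e)"
    and "halts_within (evaluator \<Sigma> N) k (config c q' (h + shift d) (act t (y, e))) r"
  shows "halts_within (evaluator \<Sigma> N) (Suc k) (config c q h t) r"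
  using halts_within_step assms by (metis step_config)

section \<open>Simulation of the stack and running time\<close>

text \<open>Nothing is said about the cells to the right of the head, so popped values may remain
  there; the blank below the bottom lets the machine detect underflow.\<close>

fun holds_stack :: "bool list \<Rightarrow> symbol tape \<Rightarrow> bool" where
  "holds_stack [] (c, h) \<longleftrightarrow> c h = Blank"
| "holds_stack (v # vs) (c, h) \<longleftrightarrow> c h = Aux (of_bool v) \<and> holds_stack vs (c, h - 1)"

lemma holds_stack_upd_above: "h < k \<Longrightarrow> holds_stack vs (c(k := y), h) = holds_stack vs (c, h)"
  by (induction vs arbitrary: h) auto

text \<open>Continuation form: \<open>m\<close> pops cost \<open>m\<close> steps, after which only
  the stack content of the tape is known, hence the quantification over \<open>t'\<close>. Underflow
  rejects at the blank within the same budget.\<close>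

lemma pop_args:
  assumes "c h = Inp s" "s \<notin> range SBit" "admissible p s" "length us + m = fst (symbol_fun s)"
    and "holds_stack vs t"
    and "m \<le> length vs \<Longrightarrow> (\<And>t'. holds_stack (drop m vs) t' \<Longrightarrow>
       halts_within (evaluator \<Sigma> N) k (config c (Scan p (us @ take m vs)) h t') r)"
    and "length vs < m \<Longrightarrow> r = to_nat Rej"
  shows "halts_within (evaluator \<Sigma> N) (m + k) (config c (Scan p us) h t) r"
  using assms(4-7)
proof (induction m arbitrary: us vs t)
  case 0
  then show ?case by simp
next
  case (Suc m)
  obtain d i where t: "t = (d, i)" by (cases t)
  show ?case
  proof (cases vs)
    case Nil
    then have "control_step (Scan p us) (c h) (scan t) = (Rej, Stay, Blank, Stay)"
      using assms(1-3) Suc.prems t by simp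
    moreover have "r = to_nat Rej" using Suc.prems(4) Nil by simp
    ultimately have "halts_within (evaluator \<Sigma> N) (Suc 0) (config c (Scan p us) h t) r"
      by (intro halts_within_config_step) (auto intro!: halts_within_now simp: config_def)
    then show ?thesis by (rule halts_within_mono) simp
  next
    case (Cons v vs')
    then have "control_step (Scan p us) (c h) (scan t)
        = (Scan p (us @ [v]), Stay, Aux (of_bool v), MoveLeft)"
      using assms(1-3) Suc.prems t by simp
    moreover have "act t (Aux (of_bool v), MoveLeft) = (d, i - 1)"
      using Suc.prems(2) Cons t by auto
    moreover have "halts_within (evaluator \<Sigma> N) (m + k) (config c (Scan p (us @ [v])) h (d, i - 1)) r"
    proof (rule Suc.IH)
      show "holds_stack vs' (d, i - 1)" using Suc.prems(2) Cons t by simp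
    qed (use Suc.prems Cons in auto)
    ultimately show ?thesis by (auto intro!: halts_within_config_step)
  qed
qed

text \<open>Each letter costs at most \<open>N\<close> pops and two steps for a push; the final 2
  pays for the blank left of the input and for \<open>Check\<close>. The list \<open>r\<close> is
  the unread prefix reversed, so it starts with the letter under the head.\<close>

lemma evaluator_scan:
  assumes "\<And>s. s \<in> set r \<Longrightarrow> fst (symbol_fun s) \<le> N"
    and "\<And>i. i < length r \<Longrightarrow> c (int i) = Inp (rev r ! i)" and "c (-1) = Blank"
    and "holds_stack vs t"
  shows "halts_within (evaluator \<Sigma> N) ((N + 2) * length r + 2)
    (config c (Scan p []) (int (length r) - 1) t) (to_nat (if evaluate p vs r then Acc else Rej))"
  using assms
proof (induction r arbitrary: p vs t)
  case Nil
  obtain d i where t: "t = (d, i)" by (cases t)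
  show ?case
  proof (cases "p = None \<and> d i = Aux 1")
    case True
    then obtain vs' where vs: "vs = True # vs'" "holds_stack vs' (d, i - 1)"
      using Nil.prems(4) t by (cases vs; cases "hd vs") auto
    \<comment> \<open>The cell below the top value is blank exactly when \<open>vs'\<close> is
      empty, which is what \<open>evaluate\<close> demands at the end.\<close>
    have "control_step Check (c (-1)) (d (i - 1))
        = (if evaluate p vs [] then Acc else Rej, Stay, d (i - 1), Stay)"
      using vs True by (cases vs') auto
    then have check: "halts_within (evaluator \<Sigma> N) (Suc 0) (config c Check (-1) (d, i - 1))
        (to_nat (if evaluate p vs [] then Acc else Rej))"
      by (intro halts_within_config_step) (auto intro!: halts_within_now simp: config_def)
    have "control_step (Scan p []) (c (-1)) (scan t) = (Check, Stay, d i, MoveLeft)"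
      using True t Nil.prems(3) by simp
    then have "halts_within (evaluator \<Sigma> N) (Suc (Suc 0)) (config c (Scan p []) (-1) t)
        (to_nat (if evaluate p vs [] then Acc else Rej))"
      by (rule halts_within_config_step[rotated]) (use check t in simp_all)
    then show ?thesis by (simp add: numeral_2_eq_2)
  next
    case False
    then have "control_step (Scan p []) (c (-1)) (scan t) = (Rej, Stay, d i, Stay)"
      using t Nil.prems(3) by auto
    moreover have "\<not> evaluate p vs []"
      using False Nil.prems(4) t by auto
    ultimately have "halts_within (evaluator \<Sigma> N) (Suc 0) (config c (Scan p []) (-1) t)
        (to_nat (if evaluate p vs [] then Acc else Rej))"
      by (intro halts_within_config_step) (auto intro!: halts_within_now simp: config_def)
    then show ?thesis by (auto elim: halts_within_mono)
  qed
next
  case (Cons s r)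
  define h where "h = int (length r)"
  let ?T = "evaluator \<Sigma> N"
  let ?k = "(N + 2) * length r + 2"
  have h: "c h = Inp s" using Cons.prems(2)[of "length r"] by (simp add: h_def nth_append)
  have IH: "halts_within ?T ?k (config c (Scan p []) (h - 1) t)
      (to_nat (if evaluate p vs r then Acc else Rej))" if "holds_stack vs t" for p vs t
    unfolding h_def
  proof (rule Cons.IH)
    show "c (int i) = Inp (rev r ! i)" if "i < length r" for i
      using Cons.prems(2)[of i] that by (simp add: nth_append)
  qed (use Cons.prems that in auto)
  obtain d i where t: "t = (d, i)" by (cases t)
  have "halts_within ?T (N + 2 + ?k) (config c (Scan p []) h t)
      (to_nat (if evaluate p vs (s # r) then Acc else Rej))"
  proof (cases "s \<in> range SBit")
    case True
    then obtain b where s: "s = SBit b" by blast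
    have "halts_within ?T (Suc ?k) (config c (Scan p []) h t)
      (to_nat (if evaluate p vs (s # r) then Acc else Rej))"
      by (rule halts_within_config_step[where q' = "Scan (Some (p = None, b)) []" and d = MoveLeft
            and y = "d i" and e = Stay])
        (use IH[OF Cons.prems(4)] s h t in auto)
    then show ?thesis by (rule halts_within_mono) simp
  next
    case False
    define n where "n = fst (symbol_fun s)"
    have n: "n \<le> N" using Cons.prems(1) by (simp add: n_def)
    show ?thesis
    proof (cases "admissible p s")
      case adm: True
      \<comment> \<open>After \<open>n\<close> pops, one step enters \<open>Push\<close> and one
        writes the value.\<close>
      have "halts_within ?T (n + Suc (Suc ?k)) (config c (Scan p []) h t)
        (to_nat (if evaluate p vs (s # r) then Acc else Rej))"
      proof (rule pop_args[where c = c and h = h, OF h False adm _ Cons.prems(4)])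
        fix t'
        assume len: "n \<le> length vs" and st: "holds_stack (drop n vs) t'"
        obtain d' i' where t': "t' = (d', i')" by (cases t')
        let ?v = "snd (symbol_fun s) (take n vs)"
        \<comment> \<open>The write hits the cell just above the remaining stack, whatever stale
          value it holds, and preserves the entries below.\<close>
        have "holds_stack (?v # drop n vs) (d'(i' + 1 := Aux (of_bool ?v)), i' + 1)"
          using st t' by (simp add: holds_stack_upd_above)
        from IH[OF this, of None]
        have "halts_within ?T ?k (config c (Scan None []) (h - 1)
            (d'(i' + 1 := Aux (of_bool ?v)), i' + 1))
            (to_nat (if evaluate p vs (s # r) then Acc else Rej))"
          using adm len False by (simp add: evaluate_not_bit n_def)
        then have push: "halts_within ?T (Suc ?k) (config c (Push ?v) h (d', i' + 1))
            (to_nat (if evaluate p vs (s # r) then Acc else Rej))"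
          by (intro halts_within_config_step) auto
        have "control_step (Scan p (take n vs)) (c h) (scan t') = (Push ?v, Stay, d' i', MoveRight)"
          using h False adm len t' by (auto simp: n_def)
        then show "halts_within ?T (Suc (Suc ?k)) (config c (Scan p ([] @ take n vs)) h t')
            (to_nat (if evaluate p vs (s # r) then Acc else Rej))"
          unfolding append_Nil by (rule halts_within_config_step[rotated]) (use push t' in simp_all)
      next
        assume "length vs < n"
        then show "to_nat (if evaluate p vs (s # r) then Acc else Rej) = to_nat Rej"
          using False by (simp add: evaluate_not_bit n_def)
      qed (simp add: n_def)
      then show ?thesis by (rule halts_within_mono) (use n in simp)
    next
      case nadm: False
      have "halts_within ?T (Suc 0) (config c (Scan p []) h t) (to_nat Rej)"
        using h False nadm
        by (intro halts_within_config_step[where q' = Rej and d = Stay and y = "scan t" and e = Stay])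
          (auto intro!: halts_within_now simp: config_def)
      then show ?thesis using False nadm
        by (auto simp: evaluate_not_bit elim: halts_within_mono)
    qed
  qed
  then show ?case by (simp add: h_def algebra_simps)
qed

text \<open>\<open>m\<close> counts the letters still to cross; the extra step is taken on the blank
  past the word and turns back by one cell.\<close>

lemma evaluator_seek:
  assumes "h + int m = int (length w)" "0 \<le> h"
    and "halts_within (evaluator \<Sigma> N) k
      (config (fst (input_tape w)) (Scan None []) (int (length w) - 1) t) r"
  shows "halts_within (evaluator \<Sigma> N) (Suc m + k) (config (fst (input_tape w)) Seek h t) r"
  using assms(1,2)
proof (induction m arbitrary: h)
  case 0
  then have "control_step Seek (fst (input_tape w) h) (scan t) = (Scan None [], MoveLeft, scan t, Stay)"
    by (simp add: input_tape_def)
  moreover have "act t (scan t, Stay) = t" by (cases t) simp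
  ultimately show ?case using 0 assms(3)
    by (auto intro!: halts_within_config_step)
next
  case (Suc m)
  have "halts_within (evaluator \<Sigma> N) (Suc m + k) (config (fst (input_tape w)) Seek (h + 1) t) r"
    by (rule Suc.IH) (use Suc.prems in auto)
  moreover have "control_step Seek (fst (input_tape w) h) (scan t) = (Seek, MoveRight, scan t, Stay)"
    using Suc.prems by (simp add: input_tape_def)
  moreover have "act t (scan t, Stay) = t" by (cases t) simp
  ultimately have "halts_within (evaluator \<Sigma> N) (Suc (Suc m + k)) (config (fst (input_tape w)) Seek h t) r"
    by (intro halts_within_config_step) auto
  then show ?case by simp
qed

text \<open>Seeking costs \<open>length w + 1\<close> steps and scanning
  \<open>(N + 2) * length w + 2\<close>, which add up to the linear polynomial.\<close>

lemma evaluator_decides: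
  assumes "\<And>s. s \<in> \<Sigma> \<Longrightarrow> fst (symbol_fun s) \<le> N"
    and "\<And>w. w \<in> lists \<Sigma> \<Longrightarrow> w \<in> L \<longleftrightarrow> evaluate None [] (rev w)"
  shows "decides_in_time \<Sigma> (evaluator \<Sigma> N) L (poly [:3, N + 3:])"
  unfolding decides_in_time_def
proof
  fix w
  assume w: "w \<in> lists \<Sigma>"
  let ?c = "fst (input_tape w)"
  let ?r = "to_nat (if evaluate None [] (rev w) then Acc else Rej)"
  have "halts_within (evaluator \<Sigma> N) ((N + 2) * length (rev w) + 2)
      (config ?c (Scan None []) (int (length (rev w)) - 1) (input_tape [])) ?r"
    by (rule evaluator_scan) (use w assms(1) in \<open>auto simp: input_tape_def\<close>)
  then have "halts_within (evaluator \<Sigma> N) (Suc (length w) + ((N + 2) * length w + 2))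
      (config ?c Seek 0 (input_tape [])) ?r"
    by (intro evaluator_seek) simp_all
  moreover have "config ?c Seek 0 (input_tape []) = initial (evaluator \<Sigma> N) w"
    by (simp add: config_def initial_def evaluator_def input_tape_def)
  moreover have "Suc (length w) + ((N + 2) * length w + 2) = poly [:3, N + 3:] (length w)"
    by (simp add: algebra_simps)
  moreover have "?r = (if w \<in> L then accept (evaluator \<Sigma> N) else reject (evaluator \<Sigma> N))"
    using assms(2)[OF w] by (simp add: evaluator_def)
  ultimately show "\<exists>k\<le>poly [:3, N + 3:] (length w).
      fst ((step (evaluator \<Sigma> N) ^^ k) (initial (evaluator \<Sigma> N) w))
      = (if w \<in> L then accept (evaluator \<Sigma> N) else reject (evaluator \<Sigma> N))"
    unfolding halts_within_def by metis
qed

theorem theorem3p7: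
  fixes B :: "boolfun set"
  assumes "finite B" and "B \<subseteq> monotone_boolfuns"
  shows "polytime_decidable (alphabet {OpF, OpG, OpX, OpU, OpS} B) (SAT {OpF, OpG, OpX, OpU, OpS} B)"
proof -
  let ?M = "{OpF, OpG, OpX, OpU, OpS}"
  let ?\<Sigma> = "alphabet ?M B"
  have fin: "finite ?\<Sigma>" using assms(1) by (simp add: alphabet_def)
  \<comment> \<open>The maximal arity depends on the fixed alphabet only, so it is a constant with
    respect to the input length.\<close>
  define N where "N = Max ((fst \<circ> symbol_fun) ` ?\<Sigma>)"
  have N: "fst (symbol_fun s) \<le> N" if "s \<in> ?\<Sigma>" for s
    unfolding N_def using fin that by (intro Max_ge) auto
  have "SAT ?M B \<subseteq> lists ?\<Sigma>"
    using encode_in_lists_alphabet by (auto simp: SAT_def)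
  moreover have "is_machine ?\<Sigma> (evaluator ?\<Sigma> N)"
    using fin N by (rule is_machine_evaluator)
  moreover have "decides_in_time ?\<Sigma> (evaluator ?\<Sigma> N) (SAT ?M B) (poly [:3, N + 3:])"
    using N SAT_iff_evaluate[OF assms(2)] by (rule evaluator_decides)
  ultimately show ?thesis
    unfolding polytime_decidable_def using fin by blast
qed

end
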